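(* Let $p>1$ and $k\geq 1$ be integers. If $G$ is a $k$-degenerate graph with $n\geq k+1$ vertices, then $e_p(G)\leq k(n-1)^p+(n-k)k^p$, with equality if and only if $G\cong S_{n,k}$.
   Context: All graphs are finite, undirected and simple. For a graph $G$, $e_p(G)=\sum_{v\in V(G)} d_G(v)^p$, where $d_G(v)$ is the degree of $v$. A graph is $k$-degenerate if every subgraph has minimum degree at most $k$. $S_{n,k}$ is the graph obtained from the complete graph $K_k$ by joining each of its vertices to each of $n-k$ additional isolated vertices. *)

theory Defs
  imports "Graph_Theory.Digraph_Isomorphism"
begin

text \<open>
  Finite simple undirected graphs are those of locale \<^locale>\<open>graph\<close>: finite loop-free
  digraphs without parallel arcs in which an edge \<open>uv\<close> is represented by the two arcs
  \<open>(u,v)\<close> and \<open>(v,u)\<close>. Hence the degree of a vertex is its out-degree, which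
  coincides with its in-degree.
\<close>

definition degree_power_sum :: "nat \<Rightarrow> ('a,'b) pre_digraph \<Rightarrow> nat" where
  "degree_power_sum p G = (\<Sum>v\<in>verts G. out_degree G v ^ p)"

definition min_degree :: "('a,'b) pre_digraph \<Rightarrow> nat" where
  "min_degree G = Min (out_degree G ` verts G)"

text \<open>
  \<^const>\<open>subgraph\<close> alone means sub-digraph; the condition \<open>graph H\<close> excludes those containing
  only one of the two arcs of an edge. The null graph has no minimum degree.
\<close>

definition degenerate :: "nat \<Rightarrow> ('a,'b) pre_digraph \<Rightarrow> bool" where
  "degenerate k G \<longleftrightarrow>
     (\<forall>H. subgraph H G \<and> graph H \<and> verts H \<noteq> {} \<longrightarrow> min_degree H \<le> k)"

text \<open>
  The graph \<open>S\<^sub>n\<^sub>,\<^sub>k\<close>, for \<open>k \<le> n\<close>: the clique is \<open>{..<k}\<close>, the additional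
  isolated vertices are \<open>{k..<n}\<close>.
\<close>

definition S_graph :: "nat \<Rightarrow> nat \<Rightarrow> nat pair_pre_digraph" where
  "S_graph n k = \<lparr> pverts = {..<k} \<union> {k..<n},
     parcs = {(u,v). u < k \<and> v < k \<and> u \<noteq> v} \<union> {..<k} \<times> {k..<n} \<union> {k..<n} \<times> {..<k} \<rparr>"

lemma graph_S_graph: "graph (with_proj (S_graph n k))"
proof -
  have "parcs (S_graph n k) \<subseteq> pverts (S_graph n k) \<times> pverts (S_graph n k)"
    by (auto simp: S_graph_def)
  moreover have "finite (pverts (S_graph n k))"
    by (simp add: S_graph_def)
  ultimately have "finite (parcs (S_graph n k))"
    by (blast intro: finite_subset)
  then interpret pair_graph "S_graph n k"
    by unfold_locales (auto simp: S_graph_def symmetric_def arcs_ends_def arc_to_ends_def sym_def)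
  show ?thesis by unfold_locales
qed

lemma card_verts_S_graph: "k \<le> n \<Longrightarrow> card (verts (with_proj (S_graph n k))) = n"
  by (simp add: S_graph_def ivl_disj_un)

end

theory Submission
  imports Defs
begin

text \<open>
  Delete a vertex \<open>v\<close> of degree at most \<open>k\<close> from a graph on \<open>n + 1\<close> vertices. The degree power sum
  drops by \<open>d(v)\<^sup>p\<close> plus one increment \<open>d(u)\<^sup>p - (d(u) - 1)\<^sup>p\<close> for each neighbour \<open>u\<close> of \<open>v\<close>. As
  \<open>p > 1\<close>, these increments are strictly increasing in \<open>d(u) \<le> n\<close>, so the drop is at most
  \<open>k\<^sup>p + k (n\<^sup>p - (n - 1)\<^sup>p)\<close>, which is exactly the difference of the two bounds; the bound follows by
  induction from \<open>n = k + 1\<close>. Equality forces \<open>v\<close> to have \<open>k\<close> neighbours, each adjacent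
  to all other vertices. These dominating vertices contribute \<open>k (n - 1)\<^sup>p\<close>, and every other vertex
  has degree at least \<open>k\<close>, hence exactly \<open>k\<close>, which gives \<open>S\<^sub>n\<^sub>,\<^sub>k\<close>.
\<close>

section \<open>Increments of powers\<close>

text \<open>The increment for exponent \<open>Suc q\<close> is \<open>Suc a\<close> times the
  increment for \<open>q\<close>, plus \<open>a ^ q\<close>. By induction on the exponent increments
  are nondecreasing in \<open>a\<close>; strictness comes from the summand \<open>a ^ q\<close> with
  \<open>q > 0\<close>, which is where \<open>p > 1\<close> enters.\<close>

lemma power_increment_strict_mono:
  assumes "p > 1"
  shows "strict_mono (\<lambda>a::nat. Suc a ^ p - a ^ p)"
proof -
  have step: "Suc a ^ Suc q - a ^ Suc q = Suc a * (Suc a ^ q - a ^ q) + a ^ q" for a q :: nat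
  proof -
    have "a ^ Suc q + a ^ q = Suc a * a ^ q" "Suc a * a ^ q \<le> Suc a * Suc a ^ q"
      by (simp, intro mult_mono power_mono) auto
    then show ?thesis
      unfolding diff_mult_distrib2 power_Suc[of "Suc a"] by linarith
  qed
  have weak: "Suc a ^ q - a ^ q \<le> Suc b ^ q - b ^ q" if "a \<le> b" for a b q :: nat
  proof (induction q)
    case (Suc q)
    then show ?case
      using that unfolding step by (intro add_mono mult_mono power_mono) auto
  qed simp
  obtain q where q: "p = Suc q" "q > 0"
    using assms by (cases p) auto
  show ?thesis
  proof (rule strict_monoI)
    fix a b :: nat
    assume "a < b"
    then have "Suc a * (Suc a ^ q - a ^ q) + a ^ q < Suc b * (Suc b ^ q - b ^ q) + b ^ q"
      using q weak[of a b q] by (intro add_le_less_mono mult_mono power_strict_mono) auto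
    then show "Suc a ^ p - a ^ p < Suc b ^ p - b ^ p"
      unfolding q step .
  qed
qed

lemma sum_eq_imp_eq_bound:
  fixes f :: "'a \<Rightarrow> nat"
  assumes "finite A" "\<And>x. x \<in> A \<Longrightarrow> f x \<le> c" "sum f A = card A * c" "x \<in> A"
  shows "f x = c"
proof (rule ccontr)
  assume "f x \<noteq> c"
  then have "sum f A < (\<Sum>x\<in>A. c)"
    using assms by (intro sum_strict_mono_ex1) (auto intro: bexI[of _ x] le_neq_implies_less)
  then show False
    using assms by simp
qed

section \<open>Vertex deletion and the inductive bound\<close>

text \<open>Deleting \<open>v\<close> lowers the degree of each neighbour by exactly one and changes
  no other remaining degree. Increments are taken at the degrees after deletion, so they have the
  form \<open>Suc a ^ p - a ^ p\<close>.\<close>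

lemma sum_degree_power_remove_vertex:
  fixes E :: "'a rel" and p :: nat
  assumes "finite W" "v \<in> W" "sym E" "irrefl E"
  shows "(\<Sum>w\<in>W. card (E `` {w} \<inter> W) ^ p) =
    (\<Sum>w\<in>W - {v}. card (E `` {w} \<inter> (W - {v})) ^ p) + card (E `` {v} \<inter> W) ^ p
    + (\<Sum>u\<in>E `` {v} \<inter> W.
        Suc (card (E `` {u} \<inter> (W - {v}))) ^ p - card (E `` {u} \<inter> (W - {v})) ^ p)"
proof -
  let ?N = "E `` {v} \<inter> W"
  let ?d = "\<lambda>w. card (E `` {w} \<inter> (W - {v}))"
  have deg: "card (E `` {w} \<inter> W) ^ p =
      ?d w ^ p + (if w \<in> ?N then Suc (?d w) ^ p - ?d w ^ p else 0)"
    if "w \<in> W - {v}" for w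
  proof (cases "w \<in> ?N")
    case True
    then have "E `` {w} \<inter> W = insert v (E `` {w} \<inter> (W - {v}))"
      using assms by (auto dest: symD)
    then have "card (E `` {w} \<inter> W) = Suc (?d w)"
      using assms(1) by simp
    then show ?thesis
      using True by (simp add: power_mono)
  next
    case False
    then have "E `` {w} \<inter> W = E `` {w} \<inter> (W - {v})"
      using assms that by (auto dest: symD)
    then show ?thesis
      using False by (simp only: if_False add_0_right)
  qed
  \<comment> \<open>Since \<open>v\<close> is not its own neighbour, a sum over \<open>?N\<close>
    extends by zeros to \<open>W - {v}\<close>.\<close>
  have "(W - {v}) \<inter> ?N = ?N"
    using assms by (auto simp: irrefl_def)
  then have N: "(\<Sum>u\<in>?N. g u) = (\<Sum>w\<in>W - {v}. if w \<in> ?N then g w else 0)" for g :: "'a \<Rightarrow> nat"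
    using sum.inter_restrict[of "W - {v}" g ?N] assms(1) by (simp only: finite_Diff)
  have "(\<Sum>w\<in>W. card (E `` {w} \<inter> W) ^ p) =
      card ?N ^ p + (\<Sum>w\<in>W - {v}. card (E `` {w} \<inter> W) ^ p)"
    using assms by (simp add: sum.remove)
  also have "(\<Sum>w\<in>W - {v}. card (E `` {w} \<inter> W) ^ p) = (\<Sum>w\<in>W - {v}. ?d w ^ p) +
      (\<Sum>w\<in>W - {v}. if w \<in> ?N then Suc (?d w) ^ p - ?d w ^ p else 0)"
    unfolding sum.distrib[symmetric] by (rule sum.cong[OF refl deg])
  finally show ?thesis
    unfolding N by simp
qed

lemma irrefl_degree_le:
  assumes "finite W" "w \<in> W" "irrefl E"
  shows "card (E `` {w} \<inter> W) \<le> card W - 1"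
proof -
  have "card (E `` {w} \<inter> W) \<le> card (W - {w})"
    using assms by (intro card_mono) (auto simp: irrefl_def)
  then show ?thesis
    using assms by simp
qed

lemma irrefl_degree_max_imp_dominating:
  assumes "finite W" "w \<in> W" "irrefl E" "card (E `` {w} \<inter> W) = card W - 1"
  shows "W - {w} \<subseteq> E `` {w}"
proof -
  have "E `` {w} \<inter> W = W - {w}"
    using assms by (intro card_subset_eq) (auto simp: irrefl_def)
  then show ?thesis
    by blast
qed

text \<open>The graph is a fixed relation \<open>E\<close> restricted to a vertex set
  \<open>W\<close>, so the induction only shrinks \<open>W\<close>, and degeneracy of all nonempty
  subsets passes to \<open>W - {v}\<close> at once. Equality yields a set of \<open>k\<close>
  dominating vertices, read off directly from the neighbourhood of the deleted vertex.\<close>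

lemma degenerate_degree_power_sum:
  fixes E :: "'a rel" and p k n :: nat
  assumes E: "sym E" "irrefl E" and p: "p > 1"
    and "k + 1 \<le> n" "finite W" "card W = n"
    and "\<And>U. U \<subseteq> W \<Longrightarrow> U \<noteq> {} \<Longrightarrow> \<exists>v\<in>U. card (E `` {v} \<inter> U) \<le> k"
  shows "(\<Sum>w\<in>W. card (E `` {w} \<inter> W) ^ p) \<le> k * (n - 1) ^ p + (n - k) * k ^ p
    \<and> ((\<Sum>w\<in>W. card (E `` {w} \<inter> W) ^ p) = k * (n - 1) ^ p + (n - k) * k ^ p
      \<longrightarrow> (\<exists>K\<subseteq>W. card K = k \<and> (\<forall>u\<in>K. W - {u} \<subseteq> E `` {u})))"
  using assms(4-)
proof (induction n arbitrary: W rule: dec_induct)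
  case base
  have le: "card (E `` {w} \<inter> W) ^ p \<le> k ^ p" if "w \<in> W" for w
    using irrefl_degree_le[of W w E] that base E by (intro power_mono) auto
  \<comment> \<open>With \<open>k + 1\<close> vertices all degrees are at most \<open>k\<close>, so
    equality makes \<open>W\<close> complete and any \<open>k\<close> of its vertices can serve as
    \<open>K\<close>.\<close>
  have bound: "k * (k + 1 - 1) ^ p + (k + 1 - k) * k ^ p = card W * k ^ p"
    using base by simp
  have "\<exists>K\<subseteq>W. card K = k \<and> (\<forall>u\<in>K. W - {u} \<subseteq> E `` {u})"
    if eq: "(\<Sum>w\<in>W. card (E `` {w} \<inter> W) ^ p) = card W * k ^ p"
  proof -
    have "W - {w} \<subseteq> E `` {w}" if "w \<in> W" for w
    proof (rule irrefl_degree_max_imp_dominating)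
      have "card (E `` {w} \<inter> W) ^ p = k ^ p"
        using sum_eq_imp_eq_bound[OF base(1) le eq that] .
      then show "card (E `` {w} \<inter> W) = card W - 1"
        using p base by (simp add: power_eq_iff_eq_base)
    qed (use that base E in auto)
    moreover obtain K where "K \<subseteq> W" "card K = k"
      using obtain_subset_with_card_n[of k W] base by auto
    ultimately show ?thesis
      by blast
  qed
  then show ?case
    unfolding bound using sum_bounded_above[of W "\<lambda>w. card (E `` {w} \<inter> W) ^ p", OF le] by simp
next
  case (step n)
  let ?D = "\<lambda>a. Suc a ^ p - a ^ p"
  obtain v where v: "v \<in> W" and vk: "card (E `` {v} \<inter> W) \<le> k"
    using step.prems(3)[of W] step.prems(2) by force
  let ?N = "E `` {v} \<inter> W"
  let ?d = "\<lambda>w. card (E `` {w} \<inter> (W - {v}))"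
  have W': "finite (W - {v})" "card (W - {v}) = n"
    using step.prems v by auto
  have n: "n > 0" "k \<le> n"
    using step.hyps by auto
  have IH: "(\<Sum>w\<in>W - {v}. ?d w ^ p) \<le> k * (n - 1) ^ p + (n - k) * k ^ p"
    using step.IH[OF W'] step.prems(3) by blast
  have mono: "?D a \<le> ?D b \<longleftrightarrow> a \<le> b" "?D a = ?D b \<longleftrightarrow> a = b" for a b
    using strict_mono_less_eq[OF power_increment_strict_mono[OF p]]
      strict_mono_eq[OF power_increment_strict_mono[OF p]] by auto
  have N: "finite ?N" "u \<in> ?N \<Longrightarrow> u \<in> W - {v}" for u
    using step.prems E by (auto simp: irrefl_def)
  \<comment> \<open>\<open>W - {v}\<close> has \<open>n\<close> vertices, so \<open>u\<close> has at
    most \<open>n - 1\<close> neighbours there.\<close>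
  have du: "?D (?d u) \<le> ?D (n - 1)" if "u \<in> ?N" for u
    unfolding mono using irrefl_degree_le[OF W'(1) N(2)[OF that] E(2)] W' by simp
  have ND: "(\<Sum>u\<in>?N. ?D (?d u)) \<le> card ?N * ?D (n - 1)"
    using sum_bounded_above[of ?N "\<lambda>u. ?D (?d u)", OF du] by simp
  have Nk: "card ?N * ?D (n - 1) \<le> k * ?D (n - 1)"
    using vk by simp
  have vp: "card ?N ^ p \<le> k ^ p"
    using vk by (simp add: power_mono)
  note total = sum_degree_power_remove_vertex[OF step.prems(1) v E, of p]
  have "n ^ p = (n - 1) ^ p + ?D (n - 1)"
    using n by (simp add: power_mono)
  then have bound: "k * (Suc n - 1) ^ p + (Suc n - k) * k ^ p =
      (k * (n - 1) ^ p + (n - k) * k ^ p) + k ^ p + k * ?D (n - 1)"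
    using n by (simp only: diff_Suc_1 Suc_diff_le add_mult_distrib2 mult_Suc)
  have "\<exists>K\<subseteq>W. card K = k \<and> (\<forall>u\<in>K. W - {u} \<subseteq> E `` {u})"
    if eq: "(\<Sum>w\<in>W. card (E `` {w} \<inter> W) ^ p) = k * (Suc n - 1) ^ p + (Suc n - k) * k ^ p"
  proof -
    \<comment> \<open>The estimates \<open>IH\<close>, \<open>vp\<close>, \<open>ND\<close> and
      \<open>Nk\<close> add up to the whole bound, so equality overall forces equality in
      each.\<close>
    have "card ?N ^ p = k ^ p" and sumN: "(\<Sum>u\<in>?N. ?D (?d u)) = card ?N * ?D (n - 1)"
      using eq IH vp ND Nk unfolding total bound by linarith+
    then have "card ?N = k"
      using p by (simp add: power_eq_iff_eq_base)
    moreover have "W - {u} \<subseteq> E `` {u}" if u: "u \<in> ?N" for u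
    proof -
      have "?d u = n - 1"
        using sum_eq_imp_eq_bound[OF N(1) du sumN u] unfolding mono by simp
      then have "W - {v} - {u} \<subseteq> E `` {u}"
        using irrefl_degree_max_imp_dominating[OF W'(1) N(2)[OF u] E(2)] W' by simp
      \<comment> \<open>The missing adjacency of \<open>u\<close> to \<open>v\<close> holds by
        symmetry, as \<open>u\<close> lies in \<open>?N\<close>.\<close>
      then show ?thesis
        using u E(1) by (auto dest: symD)
    qed
    ultimately show ?thesis
      by blast
  qed
  moreover have "(\<Sum>w\<in>W. card (E `` {w} \<inter> W) ^ p) \<le> k * (Suc n - 1) ^ p + (Suc n - k) * k ^ p"
    using IH vp ND Nk unfolding total bound by linarith
  ultimately show ?case
    by blast
qed

section \<open>Structure in the case of equality\<close>

text \<open>An edge between two vertices outside \<open>K\<close> would push a degree above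
  \<open>k\<close>, while the sum leaves only \<open>k ^ p\<close> on average for the vertices
  outside \<open>K\<close>, all of which have degree at least \<open>k\<close>.\<close>

lemma dominating_set_degree_power_sum_eq:
  fixes E :: "'a rel" and p k n :: nat
  assumes E: "sym E" "irrefl E" and p: "p > 0"
    and W: "finite W" "card W = n" and K: "K \<subseteq> W" "card K = k"
    and dom: "\<And>u. u \<in> K \<Longrightarrow> W - {u} \<subseteq> E `` {u}"
    and eq: "(\<Sum>w\<in>W. card (E `` {w} \<inter> W) ^ p) = k * (n - 1) ^ p + (n - k) * k ^ p"
    and w: "w \<in> W - K"
  shows "E `` {w} \<inter> W = K"
proof -
  have finK: "finite K"
    using K W finite_subset by blast
  have "card (E `` {u} \<inter> W) = n - 1" if "u \<in> K" for u
  proof -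
    have "E `` {u} \<inter> W = W - {u}"
      using dom[OF that] E by (auto simp: irrefl_def)
    then show ?thesis
      using that K W by auto
  qed
  then have "(\<Sum>w\<in>K. card (E `` {w} \<inter> W) ^ p) = k * (n - 1) ^ p"
    using K by simp
  then have sum: "(\<Sum>w\<in>W - K. card (E `` {w} \<inter> W) ^ p) = (\<Sum>w\<in>W - K. k ^ p)"
    using eq sum.subset_diff[OF K(1) W(1), of "\<lambda>w. card (E `` {w} \<inter> W) ^ p"] K W finK
    by (simp add: card_Diff_subset)
  have sub: "K \<subseteq> E `` {x} \<inter> W" if "x \<in> W - K" for x
    using dom that K E(1) by (auto dest: symD)
  then have le: "k ^ p \<le> card (E `` {x} \<inter> W) ^ p" if "x \<in> W - K" for x
    using that K W by (auto intro!: power_mono card_mono)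
  have "card (E `` {w} \<inter> W) ^ p = k ^ p"
  proof (rule ccontr)
    assume "card (E `` {w} \<inter> W) ^ p \<noteq> k ^ p"
    then have "k ^ p < card (E `` {w} \<inter> W) ^ p"
      using le[OF w] by simp
    then have "(\<Sum>w\<in>W - K. k ^ p) < (\<Sum>w\<in>W - K. card (E `` {w} \<inter> W) ^ p)"
      using w le W by (intro sum_strict_mono_ex1) auto
    then show False
      using sum by simp
  qed
  then have "card (E `` {w} \<inter> W) = k"
    using p by (simp add: power_eq_iff_eq_base)
  then show ?thesis
    using sub[OF w] K W by (metis card_subset_eq finite_Int)
qed

section \<open>From graphs to relations\<close>

text \<open>Links degrees counted by arcs to the relational degrees of the induction: without
  parallel arcs, \<open>head G\<close> is injective on the arcs leaving \<open>v\<close>.\<close>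

lemma (in nomulti_digraph) out_degree_conv_card_Image:
  "out_degree G v = card (arcs_ends G `` {v})"
proof -
  have "arcs_ends G `` {v} = head G ` out_arcs G v"
    by (auto simp: arcs_ends_conv)
  moreover have "inj_on (head G) (out_arcs G v)"
    by (auto intro!: inj_onI no_multi_arcs simp: arc_to_ends_def)
  ultimately show ?thesis
    by (simp add: out_degree_def card_image)
qed

lemma (in wf_digraph) arcs_ends_in_verts: "arcs_ends G \<subseteq> verts G \<times> verts G"
  by (auto simp: arcs_ends_conv)

lemma (in loopfree_digraph) irrefl_arcs_ends: "irrefl (arcs_ends G)"
  by (auto simp: irrefl_def arcs_ends_conv dest: no_loops)

lemma (in graph) graph_induce_subgraph:
  assumes "U \<subseteq> verts G"
  shows "graph (G \<restriction> U)"
proof -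
  interpret H: digraph "G \<restriction> U"
    using assms by (intro digraph_subgraph) (auto intro: subgraph_induce_subgraphI)
  show ?thesis
    using sym_arcs by (intro H.graphI) (fastforce simp: symmetric_conv)
qed

text \<open>The subgraph induced on \<open>U\<close> is again symmetric, so it is an admissible
  \<open>H\<close> in \<open>degenerate\<close>, and its minimum degree is attained at a vertex of
  \<open>U\<close>.\<close>

lemma (in graph) degenerate_induced:
  assumes "degenerate k G" "U \<subseteq> verts G" "U \<noteq> {}"
  shows "\<exists>v\<in>U. card (arcs_ends G `` {v} \<inter> U) \<le> k"
proof -
  interpret H: graph "G \<restriction> U"
    using assms(2) by (rule graph_induce_subgraph)
  have "subgraph (G \<restriction> U) G"
    using assms(2) by (rule subgraph_induce_subgraphI)
  then have "min_degree (G \<restriction> U) \<le> k"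
    using assms H.graph_axioms by (auto simp: degenerate_def)
  moreover have "min_degree (G \<restriction> U) \<in> out_degree (G \<restriction> U) ` U"
    using assms(3) H.finite_verts unfolding min_degree_def induce_subgraph_verts
    by (intro Min_in) auto
  ultimately obtain v where "v \<in> U" "out_degree (G \<restriction> U) v \<le> k"
    by auto
  moreover have "arcs_ends (G \<restriction> U) `` {v} = arcs_ends G `` {v} \<inter> U" if "v \<in> U" for v
    using that by (auto simp: arcs_ends_conv)
  ultimately show ?thesis
    by (auto simp: H.out_degree_conv_card_Image)
qed

lemma (in graph) degree_power_sum_conv:
  "degree_power_sum p G = (\<Sum>v\<in>verts G. card (arcs_ends G `` {v} \<inter> verts G) ^ p)"
proof -
  have "arcs_ends G `` {v} \<inter> verts G = arcs_ends G `` {v}" for v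
    using arcs_ends_in_verts by auto
  then show ?thesis
    by (simp add: degree_power_sum_def out_degree_conv_card_Image)
qed

section \<open>The extremal graph up to isomorphism\<close>

lemma degree_power_sum_digraph_iso:
  assumes "digraph_iso G H"
  shows "degree_power_sum p H = degree_power_sum p G"
proof -
  obtain f where f: "pre_digraph.digraph_isomorphism G f" and H: "H = app_iso f G"
    using assms by (auto simp: digraph_iso_def)
  interpret wf_digraph G
    using f by (simp add: pre_digraph.digraph_isomorphism_def)
  show ?thesis
    using digraph_isomorphism_inj_on_verts[OF f] out_degree_app_iso_eq[OF f]
    by (simp add: degree_power_sum_def H sum.reindex)
qed

lemma degree_power_sum_S_graph:
  assumes "k \<le> n"
  shows "degree_power_sum p (with_proj (S_graph n k)) = k * (n - 1) ^ p + (n - k) * k ^ p"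
proof -
  interpret graph "with_proj (S_graph n k)"
    by (rule graph_S_graph)
  have ends: "arcs_ends (with_proj (S_graph n k)) = parcs (S_graph n k)"
    by (simp add: arcs_ends_conv)
  have "parcs (S_graph n k) `` {v} = {..<n} - {v}" if "v < k" for v
    using that assms by (auto simp: S_graph_def)
  then have clique: "out_degree (with_proj (S_graph n k)) v = n - 1" if "v < k" for v
    using that assms by (simp add: out_degree_conv_card_Image ends)
  have "parcs (S_graph n k) `` {v} = {..<k}" if "v \<in> {k..<n}" for v
    using that assms by (auto simp: S_graph_def)
  then have rest: "out_degree (with_proj (S_graph n k)) v = k" if "v \<in> {k..<n}" for v
    using that by (simp add: out_degree_conv_card_Image ends)
  have "verts (with_proj (S_graph n k)) = {..<k} \<union> {k..<n}"
    by (simp add: S_graph_def)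
  then show ?thesis
    using clique rest by (simp add: degree_power_sum_def sum.union_disjoint ivl_disj_int)
qed

text \<open>In both graphs two distinct vertices are adjacent iff at least one lies in the clique
  part. Hence any bijection of the vertex sets that maps \<open>K\<close> onto \<open>{..<k}\<close>
  is an isomorphism.\<close>

lemma (in graph) digraph_iso_S_graphI:
  assumes n: "card (verts G) = n" and K: "K \<subseteq> verts G" "card K = k"
    and dom: "\<And>u. u \<in> K \<Longrightarrow> verts G - {u} \<subseteq> arcs_ends G `` {u}"
    and rest: "\<And>w. w \<in> verts G - K \<Longrightarrow> arcs_ends G `` {w} \<inter> verts G = K"
  shows "digraph_iso G (with_proj (S_graph n k))"
proof -
  have finK: "finite K"
    using K finite_subset finite_verts by blast
  have kn: "k \<le> n"
    using K n by (metis card_mono finite_verts)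
  obtain g where g: "bij_betw g K {..<k}"
    using finK K by (metis bij_betw_iff_card card_lessThan finite_lessThan)
  have "card (verts G - K) = card {k..<n}"
    using K n finK by (simp add: card_Diff_subset)
  then obtain h where h: "bij_betw h (verts G - K) {k..<n}"
    by (metis bij_betw_iff_card finite_Diff finite_atLeastLessThan finite_verts)
  define f where "f u = (if u \<in> K then g u else h u)" for u
  have fK: "bij_betw f K {..<k}"
    using g by (rule bij_betw_cong[THEN iffD1, rotated]) (simp add: f_def)
  have fR: "bij_betw f (verts G - K) {k..<n}"
    using h by (rule bij_betw_cong[THEN iffD1, rotated]) (simp add: f_def)
  have "bij_betw f (K \<union> (verts G - K)) ({..<k} \<union> {k..<n})"
    using fK fR by (rule bij_betw_combine) auto
  moreover have "K \<union> (verts G - K) = verts G"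
    using K by auto
  ultimately have f: "bij_betw f (verts G) ({..<k} \<union> {k..<n})"
    by simp
  have inj: "inj_on f (verts G)"
    using f by (rule bij_betw_imp_inj_on)
  have lt: "f u < k \<longleftrightarrow> u \<in> K" if "u \<in> verts G" for u
    using that bij_betwE[OF fK] bij_betwE[OF fR] by (cases "u \<in> K") force+
  have adj: "(u, w) \<in> arcs_ends G \<longleftrightarrow> u \<noteq> w \<and> (u \<in> K \<or> w \<in> K)"
    if "u \<in> verts G" "w \<in> verts G" for u w
    using that dom[of u] rest[of u] K irrefl_arcs_ends unfolding irrefl_def by blast
  \<comment> \<open>Arcs of \<open>S_graph\<close> are ordered pairs of vertices, so the arc map is
    forced by \<open>f\<close>; it is injective because \<open>G\<close> has no parallel
    arcs.\<close>
  define \<phi> where "\<phi> = \<lparr> iso_verts = f, iso_arcs = (\<lambda>a. (f (tail G a), f (head G a))),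
    iso_head = snd, iso_tail = fst \<rparr>"
  have "inj_on (iso_arcs \<phi>) (arcs G)"
    using inj by (auto simp: \<phi>_def arc_to_ends_def inj_on_eq_iff intro!: inj_onI no_multi_arcs)
  then have iso: "digraph_isomorphism \<phi>"
    using inj wf_digraph by (auto simp: digraph_isomorphism_def \<phi>_def)
  \<comment> \<open>Puts the arcs of \<open>S_graph\<close> in the same form as \<open>adj\<close>,
    so that \<open>lt\<close> translates one into the other.\<close>
  have S: "parcs (S_graph n k) = {(x, y) \<in> pverts (S_graph n k) \<times> pverts (S_graph n k).
      x \<noteq> y \<and> (x < k \<or> y < k)}"
    by (auto simp: S_graph_def)
  have verts: "pverts (S_graph n k) = f ` verts G"
    using f by (simp add: S_graph_def bij_betw_def)
  have "iso_arcs \<phi> ` arcs G = (\<lambda>(u, w). (f u, f w)) ` arcs_ends G"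
    by (simp add: \<phi>_def arcs_ends_conv image_image)
  also have "\<dots> = parcs (S_graph n k)"
  proof (intro equalityI subsetI)
    fix x assume "x \<in> (\<lambda>(u, w). (f u, f w)) ` arcs_ends G"
    then obtain u w where "x = (f u, f w)" "(u, w) \<in> arcs_ends G"
      by auto
    moreover from this have "u \<in> verts G" "w \<in> verts G"
      using arcs_ends_in_verts by auto
    ultimately show "x \<in> parcs (S_graph n k)"
      unfolding S verts using adj[of u w] lt inj by (auto dest: inj_onD)
  next
    fix x assume "x \<in> parcs (S_graph n k)"
    then obtain u w where "x = (f u, f w)" "u \<in> verts G" "w \<in> verts G" "f u \<noteq> f w"
      "f u < k \<or> f w < k"
      unfolding S verts by auto
    moreover from this have "(u, w) \<in> arcs_ends G"
      using adj[of u w] lt by auto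
    ultimately show "x \<in> (\<lambda>(u, w). (f u, f w)) ` arcs_ends G"
      by force
  qed
  finally have "with_proj (S_graph n k) = app_iso \<phi> G"
    using verts by (simp add: app_iso_def with_proj_def \<phi>_def)
  with iso show ?thesis
    by (auto simp: digraph_iso_def)
qed

theorem theorem4:
  fixes G :: "('a,'b) pre_digraph" and p k n :: nat
  assumes "p > 1" and "k \<ge> 1"
    and "graph G" and "degenerate k G"
    and "card (verts G) = n" and "n \<ge> k + 1"
  shows "degree_power_sum p G \<le> k * (n - 1) ^ p + (n - k) * k ^ p
    \<and> (degree_power_sum p G = k * (n - 1) ^ p + (n - k) * k ^ p
         \<longleftrightarrow> digraph_iso G (with_proj (S_graph n k)))"
proof -
  interpret graph G
    by fact
  have E: "sym (arcs_ends G)" "irrefl (arcs_ends G)"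
    using sym_arcs irrefl_arcs_ends by (auto simp: symmetric_def)
  note main = degenerate_degree_power_sum[OF E assms(1,6) finite_verts assms(5)
    degenerate_induced[OF assms(4)], folded degree_power_sum_conv]
  have "digraph_iso G (with_proj (S_graph n k))"
    if eq: "degree_power_sum p G = k * (n - 1) ^ p + (n - k) * k ^ p"
  proof -
    obtain K where K: "K \<subseteq> verts G" "card K = k"
      and dom: "\<And>u. u \<in> K \<Longrightarrow> verts G - {u} \<subseteq> arcs_ends G `` {u}"
      using main eq by blast
    have p: "p > 0"
      using assms(1) by simp
    show ?thesis
      using digraph_iso_S_graphI[OF assms(5) K dom]
        dominating_set_degree_power_sum_eq[OF E p finite_verts assms(5) K dom
          eq[unfolded degree_power_sum_conv]] by blast
  qed
  moreover have "degree_power_sum p G = k * (n - 1) ^ p + (n - k) * k ^ p"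
    if "digraph_iso G (with_proj (S_graph n k))"
    using degree_power_sum_digraph_iso[OF that, of p] degree_power_sum_S_graph[of k n p] assms(6)
    by simp
  ultimately show ?thesis
    using main by blast
qed

end
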